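(* Let $n,g,q,r$ be integers with $3\le g\le n-1$, and suppose the unicyclic graph $U_g^{n-g}$ has order $n=q^2+r$ with $1\le r\le q-1$. If $2r+1\le g\le q^2$ and $(g,n-g)\notin\mathcal A$, where $\mathcal A=\{(2q+1,\,q^2-q-2),\ (q^2-2,\,q+1)\}$, then $$b(U_g^{n-g})=\lceil\sqrt n\,\rceil-1=q.$$
   Context: All graphs are finite and simple. Burning number: at time $0$ all vertices of $G$ are unburned. In each round $t\ge1$, one new unburned vertex is chosen to burn (if such a vertex exists), and every unburned neighbour of a vertex that was burned by the end of the previous round becomes burned; burned vertices stay burned. The process ends when all vertices are burned. $b(G)$ is the smallest $k$ such that $G$ can be completely burned within $k$ rounds by a suitable choice of vertices. $U_g^{n-g}$ is the unicyclic graph of order $n$ obtained from a cycle $C_g=v_1v_2\cdots v_gv_1$ by attaching at $v_g$ one path contributing $n-g\ge1$ new vertices, one end of which is adjacent to $v_g$. *)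

theory Defs
  imports Complex_Main "Graph_Theory.Pair_Digraph"
begin

text \<open>
  A finite simple graph is a \<^typ>\<open>'a pair_pre_digraph\<close> in the locale \<^locale>\<open>pair_graph\<close>:
  finite, loop-free and symmetric, with each edge present as a pair of opposite arcs.
\<close>

text \<open>
  One round turns the set \<open>B\<close> of vertices burned so far into \<open>B'\<close>.  The new source \<open>v\<close> only has to
  be unburned at the start of the round; it may also be reached by the fire in that round.
\<close>

definition burning_round :: "'a pair_pre_digraph \<Rightarrow> 'a set \<Rightarrow> 'a set \<Rightarrow> bool" where
  "burning_round G B B' \<longleftrightarrow>
     (if pverts G - B = {} then B' = B
      else \<exists>v \<in> pverts G - B. B' = B \<union> {v} \<union> {w \<in> pverts G. \<exists>u \<in> B. (u, w) \<in> parcs G})"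

definition burnable_within :: "'a pair_pre_digraph \<Rightarrow> nat \<Rightarrow> bool" where
  "burnable_within G k \<longleftrightarrow>
     (\<exists>B :: nat \<Rightarrow> 'a set. B 0 = {} \<and> (\<forall>t<k. burning_round G (B t) (B (Suc t))) \<and> B k = pverts G)"

definition burning_number :: "'a pair_pre_digraph \<Rightarrow> nat" where
  "burning_number G = (LEAST k. burnable_within G k)"

text \<open>
  The graph \<open>U_g^m\<close>, with \<open>v_i\<close> represented by \<open>i\<close>: the cycle \<open>1, \<dots>, g\<close>, and the path
  \<open>g + 1, \<dots>, g + m\<close> attached at \<open>g\<close>.  It is meant for \<open>g \<ge> 3\<close>.
\<close>

definition unicyclic :: "nat \<Rightarrow> nat \<Rightarrow> nat pair_pre_digraph" where
  "unicyclic g m =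
     \<lparr> pverts = {1..g + m},
       parcs = symcl ({(i, i + 1) | i. 1 \<le> i \<and> i < g} \<union> {(g, 1)}
                      \<union> {(i, i + 1) | i. g \<le> i \<and> i < g + m}) \<rparr>"

lemma card_pverts_unicyclic: "card (pverts (unicyclic g m)) = g + m"
  by (simp add: unicyclic_def)

lemma pair_graph_unicyclic:
  assumes "3 \<le> g"
  shows "pair_graph (unicyclic g m)"
proof
  show "finite (pverts (unicyclic g m))"
    by (simp add: unicyclic_def)
  have sub: "parcs (unicyclic g m) \<subseteq> {1..g + m} \<times> {1..g + m}"
    using assms by (auto simp: unicyclic_def symcl_def)
  then show "finite (parcs (unicyclic g m))"
    by (rule finite_subset) simp
  show "fst e \<in> pverts (unicyclic g m)" "snd e \<in> pverts (unicyclic g m)" 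
    if "e \<in> parcs (unicyclic g m)" for e
    using that sub by (auto simp: unicyclic_def)
  show "fst e \<noteq> snd e" if "e \<in> parcs (unicyclic g m)" for e
    using that assms by (auto simp: unicyclic_def symcl_def)
  show "symmetric (with_proj (unicyclic g m))"
  proof -
    have "sym (symcl R)" for R :: "nat rel"
      by (rule symI) (force simp: symcl_def)
    then show ?thesis
      by (simp add: symmetric_def unicyclic_def)
  qed
qed

lemma burnable_within_exists:
  assumes "finite (pverts G)"
  shows "\<exists>k. burnable_within G k"
proof -
  have "\<exists>B' \<subseteq> pverts G. burning_round G B B' \<and> B \<subseteq> B' \<and> (B = pverts G \<or> B \<subset> B')"
    if "B \<subseteq> pverts G" for B
  proof (cases "B = pverts G")
    case True
    then show ?thesis by (intro exI[of _ B]) (simp add: burning_round_def)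
  next
    case False
    with that obtain v where "v \<in> pverts G - B" by blast
    then show ?thesis
      using that by (intro exI[of _ "B \<union> {v} \<union> {w \<in> pverts G. \<exists>u \<in> B. (u, w) \<in> parcs G}"])
        (auto simp: burning_round_def)
  qed
  then obtain F where F: "\<And>B. B \<subseteq> pverts G \<Longrightarrow>
      F B \<subseteq> pverts G \<and> burning_round G B (F B) \<and> B \<subseteq> F B \<and> (B = pverts G \<or> B \<subset> F B)"
    by metis
  define B where "B t = (F ^^ t) {}" for t
  have sub: "B t \<subseteq> pverts G" for t
    unfolding B_def by (induction t) (use F in auto)
  have rnd: "burning_round G (B t) (B (Suc t))" for t
    using F[OF sub[of t]] by (simp add: B_def)
  have "B t = pverts G \<or> t \<le> card (B t)" for t
  proof (induction t)
    case (Suc t)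
    have fin: "finite (B (Suc t))"
      using sub assms by (rule finite_subset)
    show ?case
    proof (cases "B t = pverts G")
      case True
      then show ?thesis using F[OF sub[of t]] by (auto simp: B_def)
    next
      case False
      then have "B t \<subset> B (Suc t)" using F[OF sub[of t]] by (simp add: B_def)
      then have "card (B t) < card (B (Suc t))" using fin by (rule psubset_card_mono[rotated])
      then show ?thesis using Suc False by simp
    qed
  qed simp
  from this[of "card (pverts G)"] have "B (card (pverts G)) = pverts G"
    using sub assms by (metis card_seteq)
  then have "burnable_within G (card (pverts G))"
    unfolding burnable_within_def using rnd by (intro exI[of _ B]) (simp add: B_def)
  then show ?thesis ..
qed

end

theory Submission
  imports Defs
begin

text \<open>
  \<^emph>\<open>At most \<open>q\<close> rounds.\<close>  A fire lit with \<open>j\<close> rounds still to come fills the ball of radius \<open>j\<close>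
  around its source, so a graph burns within \<open>q\<close> rounds as soon as balls of radii \<open>0, \<dots>, q - 1\<close>
  cover it (\<open>burnable_within_if_covered\<close>).  On a path the ball of radius \<open>j\<close> has at most \<open>2 j + 1\<close>
  vertices, and these odd numbers sum to \<open>q\<^sup>2\<close>; the missing \<open>r\<close> vertices have to come from the
  branch vertex \<open>g\<close>, where a ball grows in three directions.  Write \<open>p = q - 1\<close> and centre the
  largest ball on the tail at distance \<open>d\<close> from \<open>g\<close>.  It covers \<open>p + d\<close> tail vertices and
  \<open>2 (p - d) + 1\<close> cycle vertices, together \<open>3 p - d + 1\<close>.  What it leaves is one segment on
  the cycle and one on the tail, to be covered by intervals of the lengths \<open>1, 3, \<dots>, 2 p - 1\<close>.

  Sums of distinct numbers from this list take every value up to \<open>p\<^sup>2\<close> except \<open>2\<close> and \<open>p\<^sup>2 - 2\<close>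
  (\<open>odd_subset_sum\<close>).  Hence two segments of total length at most \<open>p\<^sup>2\<close> can be covered unless the
  total is exactly \<open>p\<^sup>2\<close> and one of them has length \<open>2\<close> (\<open>odd_lengths_split\<close>).  With \<open>d = p - r\<close>
  the total is exactly \<open>p\<^sup>2\<close>, provided that the ball overshoots neither the tail nor, by
  \<open>2 r + 1 \<le> g\<close>, the cycle.  If a segment then has length \<open>2\<close>, moving the centre one step towards
  the cycle repairs this, except that for \<open>r = p\<close> the centre is already at \<open>g\<close>: the two pairs
  \<open>(g, n - g)\<close> excluded from the theorem are precisely these two failures.  Short tails are
  handled by letting the ball end at the tip of the tail, or by \<open>d = 0\<close>
  (\<open>hub_position_exists\<close>).

  \<^emph>\<open>At least \<open>q\<close> rounds.\<close>  All degrees are at most \<open>2\<close> except for one vertex of degree \<open>3\<close>.  In a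
  round the fire crosses every arc that leaves the burned set; as a newly reached vertex uses up
  one of its arcs, spreading does not increase the number of such arcs, and each new source adds
  two; the branch vertex contributes one more, once.  So at most \<open>2 t + 1\<close> arcs leave the burned set
  after \<open>t\<close> rounds, and at most \<open>t (t + 1)\<close> vertices are burned (\<open>burned_bound\<close>).  For
  \<open>t = q - 1\<close> this is less than \<open>q\<^sup>2 < n\<close>.
\<close>

section \<open>Covering by balls\<close>

definition closed_nbhd :: "'a pair_pre_digraph \<Rightarrow> 'a set \<Rightarrow> 'a set" where
  "closed_nbhd G X = X \<union> {w \<in> pverts G. \<exists>u \<in> X. (u, w) \<in> parcs G}"

definition graph_ball :: "'a pair_pre_digraph \<Rightarrow> 'a \<Rightarrow> nat \<Rightarrow> 'a set" where
  "graph_ball G c k = (closed_nbhd G ^^ k) {c}"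

lemma graph_ball_0 [simp]: "graph_ball G c 0 = {c}"
  by (simp add: graph_ball_def)

lemma graph_ball_Suc: "graph_ball G c (Suc k) = closed_nbhd G (graph_ball G c k)"
  by (simp add: graph_ball_def)

lemma closed_nbhd_mono: "X \<subseteq> Y \<Longrightarrow> closed_nbhd G X \<subseteq> closed_nbhd G Y"
  by (auto simp: closed_nbhd_def)

lemma graph_ball_mono:
  assumes "j \<le> k"
  shows "graph_ball G c j \<subseteq> graph_ball G c k"
  using assms
  by (induction k rule: dec_induct) (auto simp: graph_ball_Suc closed_nbhd_def)

text \<open>
  The sources need not be distinct, nor unburned when their turn comes: a planned source that is
  already burned is replaced by an arbitrary unburned vertex, which only helps.
\<close>

lemma burnable_within_if_covered:
  assumes cover: "\<And>w. w \<in> pverts G \<Longrightarrow> \<exists>j<k. c j \<in> pverts G \<and> w \<in> graph_ball G (c j) j"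
  shows "burnable_within G k"
proof -
  have "\<exists>B'. B \<subseteq> pverts G \<longrightarrow> burning_round G B B' \<and> B' \<subseteq> pverts G \<and> closed_nbhd G B \<subseteq> B'
          \<and> (c (k - Suc t) \<in> pverts G \<longrightarrow> c (k - Suc t) \<in> B')" for t B
  proof (cases "pverts G - B = {}")
    case True
    then show ?thesis
      by (intro exI[of _ B]) (auto simp: burning_round_def closed_nbhd_def)
  next
    case False
    then obtain v where "v \<in> pverts G - B"
      and "c (k - Suc t) \<in> pverts G - B \<longrightarrow> v = c (k - Suc t)"
      by blast
    then show ?thesis
      by (intro exI[of _ "B \<union> {v} \<union> {w \<in> pverts G. \<exists>u \<in> B. (u, w) \<in> parcs G}"])
        (auto simp: burning_round_def closed_nbhd_def)
  qed
  then have "\<forall>t B. \<exists>B'. B \<subseteq> pverts G \<longrightarrow> burning_round G B B' \<and> B' \<subseteq> pverts G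
      \<and> closed_nbhd G B \<subseteq> B' \<and> (c (k - Suc t) \<in> pverts G \<longrightarrow> c (k - Suc t) \<in> B')"
    by blast
  then obtain F where F: "\<And>t B. B \<subseteq> pverts G \<Longrightarrow> burning_round G B (F t B)
      \<and> F t B \<subseteq> pverts G \<and> closed_nbhd G B \<subseteq> F t B
      \<and> (c (k - Suc t) \<in> pverts G \<longrightarrow> c (k - Suc t) \<in> F t B)"
    by metis
  define B where "B = rec_nat {} F"
  have sub: "B t \<subseteq> pverts G" for t
    by (induction t) (use F in \<open>auto simp: B_def\<close>)
  have round: "burning_round G (B t) (B (Suc t))"
    and nbhd: "closed_nbhd G (B t) \<subseteq> B (Suc t)"
    and source: "c (k - Suc t) \<in> pverts G \<Longrightarrow> c (k - Suc t) \<in> B (Suc t)" for t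
    using F[OF sub[of t], of t] by (auto simp: B_def)
  \<comment> \<open>The source of radius \<open>j\<close> is lit in round \<open>k - j\<close>.\<close>
  have ball: "graph_ball G (c j) i \<subseteq> B (k - j + i)" if "j < k" "c j \<in> pverts G" for j i
  proof (induction i)
    case 0
    show ?case
      using source[of "k - Suc j"] that by (simp add: Suc_diff_Suc)
  next
    case (Suc i)
    show ?case
      using closed_nbhd_mono[OF Suc, of G] nbhd[of "k - j + i"] by (simp add: graph_ball_Suc)
  qed
  have "pverts G \<subseteq> B k"
  proof
    fix w
    assume "w \<in> pverts G"
    from cover[OF this] obtain j where "j < k" "c j \<in> pverts G" "w \<in> graph_ball G (c j) j"
      by blast
    then show "w \<in> B k" using ball[of j j] by auto
  qed
  with sub[of k] have "B k = pverts G" by blast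
  then show ?thesis
    unfolding burnable_within_def using round by (intro exI[of _ B]) (simp add: B_def)
qed

section \<open>Splitting an interval among odd lengths\<close>

text \<open>
  The intervals are cut off from the right end one after the other.  The centres in use stay inside
  the segment even where an interval is longer than what is left, so that they can serve as sources.
\<close>

lemma segment_covered_by_intervals:
  fixes S :: "nat set"
  assumes "finite S" and "a \<le> (\<Sum>j\<in>S. 2 * j + 1)"
  shows "\<exists>c. \<forall>w \<in> {x<..x + a}. \<exists>j \<in> S. c j \<in> {x<..x + a} \<and> w \<le> c j + j \<and> c j \<le> w + j"
  using assms
proof (induction S arbitrary: a rule: finite_induct)
  case empty
  then show ?case by simp
next
  case (insert i S)
  then have "a - (2 * i + 1) \<le> (\<Sum>j\<in>S. 2 * j + 1)" by simp
  from insert.IH[OF this] obtain c where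
    c: "\<And>w. w \<in> {x<..x + (a - (2 * i + 1))} \<Longrightarrow>
      \<exists>j \<in> S. c j \<in> {x<..x + (a - (2 * i + 1))} \<and> w \<le> c j + j \<and> c j \<le> w + j"
    by blast
  define c' where "c' = c(i := max (x + 1) (x + a - i))"
  have "\<exists>j \<in> insert i S. c' j \<in> {x<..x + a} \<and> w \<le> c' j + j \<and> c' j \<le> w + j"
    if w: "w \<in> {x<..x + a}" for w
  proof (cases "w \<le> x + (a - (2 * i + 1))")
    case True
    with w c[of w] obtain j where "j \<in> S" "c j \<in> {x<..x + (a - (2 * i + 1))}"
      "w \<le> c j + j" "c j \<le> w + j"
      by auto
    moreover have "c' j = c j"
      using \<open>j \<in> S\<close> insert.hyps by (auto simp: c'_def)
    ultimately show ?thesis by (intro bexI[of _ j]) auto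
  next
    case False
    with w show ?thesis by (intro bexI[of _ i]) (auto simp: c'_def max_def)
  qed
  then show ?case by blast
qed

lemma sum_odd_lessThan: "(\<Sum>j<n. 2 * j + 1) = (n\<^sup>2 :: nat)"
  by (induction n) (auto simp: power2_eq_square)

text \<open>
  By induction, either without the top length \<open>2 n + 1\<close> or with it.  The top length is used when
  \<open>s\<close> exceeds \<open>n\<^sup>2\<close> or hits the gap \<open>n\<^sup>2 - 2\<close> of the shorter list; the remainder then lies in a gap
  of that list only if \<open>s\<close> itself was excluded.
\<close>

lemma odd_subset_sum:
  assumes "s \<le> n\<^sup>2" and "s \<noteq> 2" and "s + 2 \<noteq> n\<^sup>2"
  shows "\<exists>S \<subseteq> {..<n}. (\<Sum>j\<in>S. 2 * j + 1) = (s::nat)"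
  using assms
proof (induction n arbitrary: s)
  case 0
  then show ?case by auto
next
  case (Suc n)
  have without: ?case if "s \<le> n\<^sup>2" "s + 2 \<noteq> n\<^sup>2"
  proof -
    from Suc.IH[OF that(1) Suc.prems(2) that(2)] obtain S
      where S: "S \<subseteq> {..<n}" and sum: "(\<Sum>j\<in>S. 2 * j + 1) = s" by blast
    from S have "S \<subseteq> {..<Suc n}" by auto
    with sum show ?thesis by (intro exI conjI)
  qed
  have with_top: ?case
    if s: "2 * n + 1 \<le> s" "s - (2 * n + 1) \<noteq> 2" "s - (2 * n + 1) + 2 \<noteq> n\<^sup>2"
  proof -
    have "s - (2 * n + 1) \<le> n\<^sup>2"
      using Suc.prems(1) by (simp add: power2_eq_square)
    from Suc.IH[OF this s(2,3)] obtain S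
      where S: "S \<subseteq> {..<n}" "(\<Sum>j\<in>S. 2 * j + 1) = s - (2 * n + 1)" by blast
    then have "finite S" "n \<notin> S" by (auto intro: finite_subset)
    then have "(\<Sum>j\<in>insert n S. 2 * j + 1) = s"
      using S(2) s(1) by simp
    moreover have "insert n S \<subseteq> {..<Suc n}" using S(1) by auto
    ultimately show ?thesis by (intro exI conjI)
  qed
  have Suc_sq: "(Suc n)\<^sup>2 = n\<^sup>2 + (2 * n + 1)" by (simp add: power2_eq_square)
  have "s \<le> n\<^sup>2 \<and> s + 2 \<noteq> n\<^sup>2 \<or>
    2 * n + 1 \<le> s \<and> s - (2 * n + 1) \<noteq> 2 \<and> s - (2 * n + 1) + 2 \<noteq> n\<^sup>2"
  proof (cases "n < 3")
    case True
    then have "n = 0 \<or> n = 1 \<or> n = 2" by linarith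
    with Suc.prems[unfolded Suc_sq] show ?thesis by (elim disjE; simp; presburger)
  next
    case False
    then obtain i where n: "n = i + 3" by (metis add.commute le_Suc_ex not_less)
    have sq: "n\<^sup>2 = i * i + 6 * i + 9" by (simp add: n power2_eq_square algebra_simps)
    \<comment> \<open>For \<open>s = n\<^sup>2 - 2\<close> the remainder is \<open>n\<^sup>2 - 2 n - 3 = i\<^sup>2 + 4 i\<close>.\<close>
    have "i * i + 4 * i \<noteq> 2"
      by (cases i) simp_all
    with sq n Suc.prems Suc_sq show ?thesis by linarith
  qed
  then show ?case using without with_top by blast
qed

text \<open>
  The first segment receives total length exactly \<open>a\<close>, or \<open>a + 1\<close> if \<open>a\<close> is one of the two values
  that are not subset sums; the assumption \<open>tight\<close> leaves room for the extra unit.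
\<close>

lemma odd_lengths_split:
  fixes a b n :: nat
  assumes ab: "a + b \<le> n\<^sup>2" and tight: "a + b = n\<^sup>2 \<Longrightarrow> a \<noteq> 2 \<and> b \<noteq> 2"
  shows "\<exists>S \<subseteq> {..<n}. a \<le> (\<Sum>j\<in>S. 2 * j + 1) \<and> b \<le> (\<Sum>j\<in>{..<n} - S. 2 * j + 1)"
proof -
  \<comment> \<open>With \<open>a + 1\<close> in place of \<open>a\<close>, a gap could be hit only if \<open>n\<^sup>2\<close> were \<open>3\<close> or \<open>5\<close>.\<close>
  define s where "s = (if a = 2 \<or> a + 2 = n\<^sup>2 then a + 1 else a)"
  have small: "n\<^sup>2 \<noteq> 3 \<and> n\<^sup>2 \<noteq> 5"
  proof (cases "n \<le> 2")
    case True
    then have "n = 0 \<or> n = 1 \<or> n = 2" by linarith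
    then show ?thesis by auto
  next
    case False
    then have "3\<^sup>2 \<le> n\<^sup>2" by (intro power_mono) auto
    then show ?thesis by simp
  qed
  have strict: "a + b + 1 \<le> n\<^sup>2" if "a = 2 \<or> a + 2 = n\<^sup>2"
    using ab tight that by linarith
  have "s \<noteq> 2 \<and> s + 2 \<noteq> n\<^sup>2 \<and> a \<le> s \<and> s + b \<le> n\<^sup>2"
  proof (cases "a = 2 \<or> a + 2 = n\<^sup>2")
    case True
    then have "s = a + 1" by (simp add: s_def)
    with True strict[OF True] small show ?thesis by linarith
  next
    case False
    then have "s = a" by (simp add: s_def)
    with False ab show ?thesis by simp
  qed
  then have "s \<noteq> 2" "s + 2 \<noteq> n\<^sup>2" and s: "a \<le> s" "s + b \<le> n\<^sup>2" by blast+
  then obtain S where S: "S \<subseteq> {..<n}" "(\<Sum>j\<in>S. 2 * j + 1) = s"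
    using odd_subset_sum[of s n] by auto
  then have "(\<Sum>j\<in>{..<n} - S. 2 * j + 1) + s = n\<^sup>2"
    using sum.subset_diff[OF S(1), of "\<lambda>j. 2 * j + 1"] sum_odd_lessThan[of n] by simp
  with S s show ?thesis by (intro exI[of _ S]) auto
qed

section \<open>Burning the unicyclic graph\<close>

text \<open>
  Consecutive numbers are always adjacent, so the graph is the path \<open>1, \<dots>, g + m\<close> with the chord
  from \<open>g\<close> to \<open>1\<close> added, and moving along the path costs at most the difference of the labels.
\<close>

lemma unicyclic_ball_extend:
  assumes "x \<in> graph_ball (unicyclic g m) c j"
    and "x \<in> {1..g + m}" "y \<in> {1..g + m}" "y \<le> x + i" "x \<le> y + i"
  shows "y \<in> graph_ball (unicyclic g m) c (j + i)"
  using assms(3-)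
proof (induction i arbitrary: y)
  case 0
  then show ?case using assms(1) by simp
next
  case (Suc i)
  have arc: "(k, k + 1) \<in> parcs (unicyclic g m) \<and> (k + 1, k) \<in> parcs (unicyclic g m)"
    if "1 \<le> k" "k < g + m" for k
    using that by (cases "k < g") (auto simp: unicyclic_def symcl_def)
  have vert: "y \<in> pverts (unicyclic g m)"
    using Suc.prems by (simp add: unicyclic_def)
  consider "y \<le> x + i" "x \<le> y + i" | "y = x + Suc i" | "x = y + Suc i"
    using Suc.prems by linarith
  then show ?case
  proof cases
    case 1
    then show ?thesis
      using Suc.IH[of y] Suc.prems(1) by (simp add: graph_ball_Suc closed_nbhd_def)
  next
    case 2
    then have "y - 1 \<in> graph_ball (unicyclic g m) c (j + i)"
      using Suc.IH[of "y - 1"] Suc.prems assms(2) by auto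
    moreover have "(y - 1, y) \<in> parcs (unicyclic g m)"
      using arc[of "y - 1"] 2 Suc.prems assms(2) by auto
    ultimately show ?thesis
      using vert by (auto simp: graph_ball_Suc closed_nbhd_def)
  next
    case 3
    then have "y + 1 \<in> graph_ball (unicyclic g m) c (j + i)"
      using Suc.IH[of "y + 1"] Suc.prems assms(2) by auto
    moreover have "(y + 1, y) \<in> parcs (unicyclic g m)"
      using arc[of y] 3 Suc.prems assms(2) by auto
    ultimately show ?thesis
      using vert by (auto simp: graph_ball_Suc closed_nbhd_def)
  qed
qed

lemma unicyclic_ball_interval:
  assumes "c \<in> {1..g + m}" "y \<in> {1..g + m}" "y \<le> c + i" "c \<le> y + i"
  shows "y \<in> graph_ball (unicyclic g m) c i"
  using unicyclic_ball_extend[of c g m c 0] assms by simp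

text \<open>From the tail vertex \<open>g + d\<close> the fire also enters the cycle through the chord, reaching \<open>y\<close>
  after \<open>d + 1 + (y - 1)\<close> steps.\<close>

lemma unicyclic_ball_around_cycle:
  assumes "1 \<le> g" "d \<le> m" "1 \<le> y" "y \<le> g" "y + d \<le> k"
  shows "y \<in> graph_ball (unicyclic g m) (g + d) k"
proof -
  have "g \<in> graph_ball (unicyclic g m) (g + d) d"
    using assms by (intro unicyclic_ball_interval) auto
  moreover have "(g, 1) \<in> parcs (unicyclic g m)" "1 \<in> pverts (unicyclic g m)"
    using assms by (auto simp: unicyclic_def symcl_def)
  ultimately have "1 \<in> graph_ball (unicyclic g m) (g + d) (Suc d)"
    by (auto simp: graph_ball_Suc closed_nbhd_def)
  then have "y \<in> graph_ball (unicyclic g m) (g + d) (Suc d + (y - 1))"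
    using assms by (intro unicyclic_ball_extend[of 1]) auto
  then show ?thesis
    using graph_ball_mono[of "Suc d + (y - 1)" k "unicyclic g m" "g + d"] assms by auto
qed

text \<open>
  Here \<open>a\<close> and \<open>b\<close> are the lengths of the segments \<open>p - d + 1, \<dots>, g - (p - d) - 1\<close> of the cycle and
  \<open>g + p + d + 1, \<dots>, g + m\<close> of the tail that the ball of radius \<open>p\<close> around \<open>g + d\<close> leaves.
  Subtraction on \<^typ>\<open>nat\<close> makes them \<open>0\<close> when the ball swallows the cycle or the tail.
\<close>

lemma unicyclic_burnable:
  assumes g: "1 \<le> g" and d: "d \<le> m" "d \<le> p"
    and a: "a = g - (2 * (p - d) + 1)" and b: "b = m - (p + d)"
    and ab: "a + b \<le> p\<^sup>2" and tight: "a + b = p\<^sup>2 \<Longrightarrow> a \<noteq> 2 \<and> b \<noteq> 2"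
  shows "burnable_within (unicyclic g m) (Suc p)"
proof -
  from odd_lengths_split[OF ab tight] obtain S where S: "S \<subseteq> {..<p}"
    "a \<le> (\<Sum>j\<in>S. 2 * j + 1)" "b \<le> (\<Sum>j\<in>{..<p} - S. 2 * j + 1)" by blast
  have "finite S" using S(1) by (rule finite_subset) simp
  from segment_covered_by_intervals[OF this S(2), of "p - d"]
  obtain c where c: "\<And>w. w \<in> {p - d<..p - d + a} \<Longrightarrow>
      \<exists>j\<in>S. c j \<in> {p - d<..p - d + a} \<and> w \<le> c j + j \<and> c j \<le> w + j" by blast
  have "finite ({..<p} - S)" by simp
  from segment_covered_by_intervals[OF this S(3), of "g + p + d"]
  obtain c' where c': "\<And>w. w \<in> {g + p + d<..g + p + d + b} \<Longrightarrow>
      \<exists>j\<in>{..<p} - S. c' j \<in> {g + p + d<..g + p + d + b} \<and> w \<le> c' j + j \<and> c' j \<le> w + j"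
    by blast
  define e where "e j = (if j = p then g + d else if j \<in> S then c j else c' j)" for j
  have verts: "pverts (unicyclic g m) = {1..g + m}" by (simp add: unicyclic_def)
  show ?thesis
  proof (rule burnable_within_if_covered[of _ _ e])
    fix w
    assume "w \<in> pverts (unicyclic g m)"
    then have w: "w \<in> {1..g + m}" by (simp add: verts)
    consider (near) "g + d \<le> w + p" "w \<le> g + d + p" | (wrap) "w \<le> g" "w + d \<le> p"
      | (cycle) "w \<in> {p - d<..p - d + a}" | (tail) "w \<in> {g + p + d<..g + p + d + b}"
      using w a b d by fastforce
    then show "\<exists>j<Suc p. e j \<in> pverts (unicyclic g m) \<and> w \<in> graph_ball (unicyclic g m) (e j) j"
    proof cases
      case near
      then have "w \<in> graph_ball (unicyclic g m) (g + d) p"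
        using w d g by (intro unicyclic_ball_interval) auto
      then show ?thesis
        using d g by (intro exI[of _ p]) (simp add: e_def verts)
    next
      case wrap
      then have "w \<in> graph_ball (unicyclic g m) (g + d) p"
        using w d g by (intro unicyclic_ball_around_cycle) auto
      then show ?thesis
        using d g by (intro exI[of _ p]) (simp add: e_def verts)
    next
      case cycle
      from c[OF this] obtain j where j: "j \<in> S" "c j \<in> {p - d<..p - d + a}"
        "w \<le> c j + j" "c j \<le> w + j" by blast
      then have "j < p" "c j \<in> {1..g + m}" using S(1) a by auto
      then show ?thesis
        using j w by (intro exI[of _ j]) (auto simp: e_def verts intro!: unicyclic_ball_interval)
    next
      case tail
      from c'[OF this] obtain j where j: "j < p" "j \<notin> S" "c' j \<in> {g + p + d<..g + p + d + b}"
        "w \<le> c' j + j" "c' j \<le> w + j" by auto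
      then have "c' j \<in> {1..g + m}" using b by auto
      then show ?thesis
        using j w by (intro exI[of _ j]) (auto simp: e_def verts intro!: unicyclic_ball_interval)
    qed
  qed
qed

section \<open>How many vertices can burn\<close>

definition out_arcs_of :: "'a pair_pre_digraph \<Rightarrow> 'a set \<Rightarrow> ('a \<times> 'a) set" where
  "out_arcs_of G B = {(u, w) \<in> parcs G. u \<in> B \<and> w \<notin> B}"

text \<open>
  A newly reached vertex has an arc back into the burned set, by symmetry, so at most \<open>1\<close> of its
  arcs leads further, or \<open>2\<close> for the branch vertex \<open>h\<close>.  This happens to \<open>h\<close> only once, hence the
  summand that depends on whether \<open>h\<close> is burned.
\<close>

lemma burned_bound:
  assumes "pair_graph G"
    and deg: "\<And>w. card {x. (w, x) \<in> parcs G} \<le> (if w = h then 3 else 2)"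
    and B0: "B 0 = {}" and step: "\<And>t. t < k \<Longrightarrow> burning_round G (B t) (B (Suc t))"
    and "t \<le> k"
  shows "B t \<subseteq> pverts G \<and> card (B t) \<le> t * (t + 1)
    \<and> card (out_arcs_of G (B t)) \<le> 2 * t + (if h \<in> B t then 1 else 0)"
  using \<open>t \<le> k\<close>
proof (induction t)
  case 0
  then show ?case by (simp add: B0 out_arcs_of_def)
next
  case (Suc t)
  interpret pair_graph G by fact
  let ?B = "B t" and ?B' = "B (Suc t)" and ?N = "\<lambda>w. {x. (w, x) \<in> parcs G}"
  have sub: "?B \<subseteq> pverts G" and cardB: "card ?B \<le> t * (t + 1)"
    and arcsB: "card (out_arcs_of G ?B) \<le> 2 * t + (if h \<in> ?B then 1 else 0)"
    using Suc by auto
  have finN: "finite (?N w)" for w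
    by (rule finite_subset[of _ "snd ` parcs G"]) (force, simp)
  show ?case
  proof (cases "pverts G - ?B = {}")
    case True
    then have "?B' = ?B" using step[of t] Suc.prems by (simp add: burning_round_def)
    then show ?thesis using sub cardB arcsB by (auto split: if_splits)
  next
    case False
    then obtain v where v: "v \<in> pverts G - ?B"
      and B': "?B' = ?B \<union> {v} \<union> {w \<in> pverts G. \<exists>u \<in> ?B. (u, w) \<in> parcs G}"
      using step[of t] Suc.prems by (auto simp: burning_round_def)
    \<comment> \<open>The vertices that the fire reaches by spreading in this round; \<open>v\<close> may be one of them.\<close>
    define D where "D = snd ` out_arcs_of G ?B"
    have D: "D = {w. w \<notin> ?B \<and> (\<exists>u \<in> ?B. (u, w) \<in> parcs G)}"
      by (force simp: D_def out_arcs_of_def)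
    have B'_eq: "?B' = ?B \<union> D \<union> ({v} - D)"
      using v wellformed unfolding B' D by force
    have fin_arcs: "finite (out_arcs_of G X)" for X
      by (rule finite_subset[of _ "parcs G"]) (auto simp: out_arcs_of_def)
    have finD: "finite D" by (simp add: D_def fin_arcs)
    have cardD: "card D \<le> 2 * t + (if h \<in> ?B then 1 else 0)"
      unfolding D_def using card_image_le[OF fin_arcs] arcsB le_trans by blast
    have B'sub: "?B' \<subseteq> pverts G" unfolding B' using sub v by auto
    have "card ?B' \<le> card ?B + card D + card ({v} - D)"
      unfolding B'_eq by (meson card_Un_le le_trans add_le_mono1)
    moreover have "card ({v} - D) \<le> 1" using card_mono[of "{v}" "{v} - D"] by simp
    ultimately have card_B': "card ?B' \<le> Suc t * (Suc t + 1)"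
      using cardB cardD by (auto split: if_splits)
    have "out_arcs_of G ?B' \<subseteq> Sigma D (\<lambda>w. ?N w - ?B) \<union> Sigma ({v} - D) ?N"
      by (auto simp: out_arcs_of_def B'_eq D)
    then have "card (out_arcs_of G ?B') \<le> card (Sigma D (\<lambda>w. ?N w - ?B) \<union> Sigma ({v} - D) ?N)"
      using finD finN by (intro card_mono) auto
    also have "\<dots> \<le> card (Sigma D (\<lambda>w. ?N w - ?B)) + card (Sigma ({v} - D) ?N)"
      by (rule card_Un_le)
    also have "card (Sigma D (\<lambda>w. ?N w - ?B)) \<le> (\<Sum>w\<in>D. 1 + (if w = h then 1 else 0))"
    proof -
      have "card (?N w - ?B) \<le> 1 + (if w = h then 1 else 0)" if w: "w \<in> D" for w
      proof -
        obtain u where "u \<in> ?B" "(u, w) \<in> parcs G" using w D by auto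
        then have "(w, u) \<in> parcs G" using arcs_symmetric by blast
        then have "?N w - ?B \<subset> ?N w" using \<open>u \<in> ?B\<close> by auto
        then have "card (?N w - ?B) < card (?N w)" using finN by (intro psubset_card_mono)
        with deg[of w] show ?thesis by (auto split: if_splits)
      qed
      then show ?thesis using finD finN by (auto intro: sum_mono)
    qed
    also have "(\<Sum>w\<in>D. 1 + (if w = h then 1 else 0)) = card D + (if h \<in> D then 1 else 0)"
      unfolding sum.distrib using finD by simp
    also have "card (Sigma ({v} - D) ?N) \<le> (if v \<in> D then 0 else if v = h then 3 else 2)"
      using deg[of v] finN by (auto simp: insert_Diff_if)
    finally have "card (out_arcs_of G ?B')
        \<le> card D + (if h \<in> D then 1 else 0) + (if v \<in> D then 0 else if v = h then 3 else 2)"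
      by simp
    also have "\<dots> \<le> 2 * Suc t + (if h \<in> ?B' then 1 else 0)"
      using cardD v unfolding B'_eq D by auto
    finally show ?thesis using B'sub card_B' by blast
  qed
qed

lemma burnable_within_card:
  assumes "pair_graph G" and "\<And>w. card {x. (w, x) \<in> parcs G} \<le> (if w = h then 3 else 2)"
    and "burnable_within G k"
  shows "card (pverts G) \<le> k * (k + 1)"
proof -
  from assms(3) obtain B where "B 0 = {}" "\<And>t. t < k \<Longrightarrow> burning_round G (B t) (B (Suc t))"
    and "B k = pverts G"
    unfolding burnable_within_def by blast
  with burned_bound[OF assms(1,2), of B k k] show ?thesis by simp
qed

lemma unicyclic_degree:
  assumes "3 \<le> g"
  shows "card {x. (w, x) \<in> parcs (unicyclic g m)} \<le> (if w = g then 3 else 2)"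
proof -
  have "{x. (w, x) \<in> parcs (unicyclic g m)} \<subseteq>
      (if w = g then {g - 1, 1, g + 1} else if w = 1 then {2, g} else {w - 1, w + 1})"
    using assms by (auto simp: unicyclic_def symcl_def)
  then have "card {x. (w, x) \<in> parcs (unicyclic g m)} \<le> card
      (if w = g then {g - 1, 1, g + 1} else if w = 1 then {2, g} else {w - 1, w + 1})"
    by (rule card_mono[rotated]) simp
  also have "\<dots> \<le> (if w = g then 3 else 2)"
    by (simp add: card_insert_if)
  finally show ?thesis .
qed

lemma burning_number_unicyclic_gt:
  assumes "3 \<le> g" and "k * (k + 1) < g + m"
  shows "k < burning_number (unicyclic g m)"
proof (rule ccontr)
  let ?b = "burning_number (unicyclic g m)"
  assume "\<not> k < ?b"
  have "finite (pverts (unicyclic g m))" by (simp add: unicyclic_def)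
  then have "burnable_within (unicyclic g m) ?b"
    unfolding burning_number_def by (rule LeastI_ex[OF burnable_within_exists])
  then have "g + m \<le> ?b * (?b + 1)"
    using burnable_within_card[OF pair_graph_unicyclic[OF assms(1)] unicyclic_degree[OF assms(1)]]
    by (simp only: card_pverts_unicyclic)
  also have "\<dots> \<le> k * (k + 1)" using \<open>\<not> k < ?b\<close> by (intro mult_mono) auto
  finally show False using assms(2) by simp
qed

section \<open>The burning number\<close>

text \<open>
  The four cases are: a tail inside the ball around \<open>g\<close>; a ball that ends at the tip of the tail;
  the centre \<open>d = p - r\<close>, where the two segments have total length \<open>p\<^sup>2\<close>; and the same centre moved
  one step towards the cycle.  That step changes the segment lengths by \<open>-2\<close> and \<open>+1\<close>.  A ball
  that swallows the tail leaves only one segment, of length at most \<open>p\<^sup>2\<close>, and this is not \<open>2\<close>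
  in the tight case because \<open>2\<close> is not a square.
\<close>

lemma hub_position_exists:
  fixes g m p r :: nat
  assumes n: "g + m = (p + 1)\<^sup>2 + r" and r: "1 \<le> r" "r \<le> p"
    and g: "2 * r + 1 \<le> g" "g \<le> (p + 1)\<^sup>2"
    and exc1: "r = p \<Longrightarrow> g \<noteq> 2 * p + 3" and exc2: "r = p \<Longrightarrow> m \<noteq> p + 2"
  shows "\<exists>d \<le> min m p. g - (2 * (p - d) + 1) + (m - (p + d)) \<le> p\<^sup>2 \<and>
    (g - (2 * (p - d) + 1) + (m - (p + d)) = p\<^sup>2 \<longrightarrow>
      g - (2 * (p - d) + 1) \<noteq> 2 \<and> m - (p + d) \<noteq> 2)"
proof -
  have sq: "(p + 1)\<^sup>2 = p\<^sup>2 + 2 * p + 1" by (simp add: power2_eq_square)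
  have p2: "p\<^sup>2 \<noteq> 2"
  proof (cases "p \<le> 1")
    case True
    then have "p = 0 \<or> p = 1" by linarith
    then show ?thesis by auto
  next
    case False
    then have "2\<^sup>2 \<le> p\<^sup>2" by (intro power_mono) auto
    then show ?thesis by simp
  qed
  consider "m \<le> p" | "p < m" "m \<le> p + (p - r)"
    | "p + (p - r) < m" "g \<noteq> 2 * r + 3" "m \<noteq> 2 * p - r + 2"
    | "p + (p - r) < m" "g = 2 * r + 3 \<or> m = 2 * p - r + 2" "r < p"
    using r exc1 exc2 by force
  then show ?thesis
  proof cases
    case 1
    then show ?thesis using n g p2 unfolding sq by (intro exI[of _ 0]) auto
  next
    case 2
    then show ?thesis using n g r p2 unfolding sq by (intro exI[of _ "m - p"]) auto
  next
    case 3
    then show ?thesis using n g r unfolding sq by (intro exI[of _ "p - r"]) auto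
  next
    case 4
    then have "2\<^sup>2 \<le> p\<^sup>2" using r by (intro power_mono) auto
    with 4 show ?thesis using n g r unfolding sq by (intro exI[of _ "p - r - 1"]) auto
  qed
qed

theorem theorem3p2:
  fixes n g q r :: int
  assumes "3 \<le> g" and "g \<le> n - 1"
    and "n = q\<^sup>2 + r" and "1 \<le> r" and "r \<le> q - 1"
    and "2 * r + 1 \<le> g" and "g \<le> q\<^sup>2"
    and "(g, n - g) \<notin> {(2 * q + 1, q\<^sup>2 - q - 2), (q\<^sup>2 - 2, q + 1)}"
  shows "int (burning_number (unicyclic (nat g) (nat (n - g)))) = \<lceil>sqrt (real_of_int n)\<rceil> - 1
    \<and> \<lceil>sqrt (real_of_int n)\<rceil> - 1 = q"
proof -
  define p where "p = nat (q - 1)"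
  define g' where "g' = nat g"
  define m where "m = nat (n - g)"
  define r' where "r' = nat r"
  have q: "q = int p + 1" and g': "g = int g'" and m: "n - g = int m" and r': "r = int r'"
    using assms by (auto simp: p_def g'_def m_def r'_def)
  have "int (g' + m) = int ((p + 1)\<^sup>2 + r')"
    using assms(3) q g' m r' by (simp add: add.commute)
  then have n': "g' + m = (p + 1)\<^sup>2 + r'" by (simp only: of_nat_eq_iff)
  have "int g' \<le> int ((p + 1)\<^sup>2)" using assms(7) q g' by (simp add: add.commute)
  then have g'_le: "g' \<le> (p + 1)\<^sup>2" by (simp only: of_nat_le_iff)
  have r'_bounds: "1 \<le> r'" "r' \<le> p" and g'_ge: "3 \<le> g'" "2 * r' + 1 \<le> g'"
    using assms q g' r' by auto
  have sq: "q\<^sup>2 = int p * int p + 2 * int p + 1"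
    by (simp add: q power2_eq_square algebra_simps)
  have exc: "g' \<noteq> 2 * p + 3" "m \<noteq> p + 2" if "r' = p"
    using assms(3,8) q g' m r' sq that by auto
  obtain d where "d \<le> m" "d \<le> p" and
    "g' - (2 * (p - d) + 1) + (m - (p + d)) \<le> p\<^sup>2"
    "g' - (2 * (p - d) + 1) + (m - (p + d)) = p\<^sup>2 \<longrightarrow>
      g' - (2 * (p - d) + 1) \<noteq> 2 \<and> m - (p + d) \<noteq> 2"
    using hub_position_exists[OF n' r'_bounds g'_ge(2) g'_le exc] by auto
  then have "burnable_within (unicyclic g' m) (Suc p)"
    using g'_ge(1) by (intro unicyclic_burnable[OF _ _ _ refl refl]) auto
  then have "burning_number (unicyclic g' m) \<le> Suc p"
    unfolding burning_number_def by (rule Least_le)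
  moreover have "p < burning_number (unicyclic g' m)"
    using g'_ge(1) n' by (intro burning_number_unicyclic_gt) (auto simp: power2_eq_square)
  ultimately have "int (burning_number (unicyclic g' m)) = q" using q by simp
  moreover have "\<lceil>sqrt (real_of_int n)\<rceil> = q + 1"
  proof (rule ceiling_unique)
    have "q\<^sup>2 < n" "n \<le> (q + 1)\<^sup>2"
      using assms by (auto simp: power2_eq_square algebra_simps)
    then have "(real_of_int q)\<^sup>2 < real_of_int n" "real_of_int n \<le> (real_of_int q + 1)\<^sup>2"
      by (metis of_int_less_iff of_int_power, metis of_int_le_iff of_int_power of_int_add of_int_1)
    then have "real_of_int q < sqrt (real_of_int n)" "sqrt (real_of_int n) \<le> real_of_int q + 1"
      using q by (intro real_less_rsqrt real_le_lsqrt; simp)+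
    then show "real_of_int (q + 1) - 1 < sqrt (real_of_int n)"
      and "sqrt (real_of_int n) \<le> real_of_int (q + 1)"
      by simp_all
  qed
  ultimately show ?thesis by (simp add: g'_def m_def)
qed

end
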